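(* Let $\mathbf{K}\subset\mathbb{R}^n\times\mathbb{R}^m$ be the basic semi-algebraic set $$\mathbf{K}=\{(x,y)\in\mathbb{R}^n\times\mathbb{R}^m : x\in\mathbf{B};\ g_j(x,y)\ge 0,\ j=1,\ldots,s\},$$ where $\mathbf{B}\subset\mathbb{R}^n$ is a box or an ellipsoid and $g_1,\ldots,g_s\in\mathbb{R}[x,y]$. Assume that $\mathbf{K}$ is compact and that $\mathbf{K}_x:=\{y\in\mathbb{R}^m:(x,y)\in\mathbf{K}\}\neq\emptyset$ for every $x\in\mathbf{B}$. Let $f\in\mathbb{R}[x,y]$, let $\overline{J_f}(x):=\max_y\{f(x,y): y\in\mathbf{K}_x\}$ for $x\in\mathbf{B}$, and let $$\mathbf{D}_f:=\{x\in\mathbf{B}: f(x,y)\ge 0\ \text{for some } y\in\mathbf{K}_x\}.$$ Assume that $\mathbf{B}$ and $\mathbf{D}_f$ have nonempty interior and that the set $\{x\in\mathbf{B}:\overline{J_f}(x)=0\}$ has Lebesgue measure zero. Let $(p_k)_{k\in\mathbb{N}}\subset\mathbb{R}[x]$ be a sequence of polynomials such that $p_k(x)\ge f(x,y)$ for all $y\in\mathbf{K}_x$, $x\in\mathbf{B}$, and all $k\in\mathbb{N}$, and $$\lim_{k\to\infty}\int_{\mathbf{B}}|p_k(x)-\overline{J_f}(x)|\,dx=0.$$ For every $k\in\mathbb{N}$ let $\mathbf{D}_f^k:=\{x\in\mathbf{B}: p_k(x)\ge 0\}$. Then $\mathbf{D}_f^k\supset\mathbf{D}_f$ for every $k$,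 and $$\mathrm{vol}\left(\mathbf{D}_f^k\setminus\mathbf{D}_f\right)\to 0\quad\text{as } k\to\infty.$$
   Context: $\mathbb{R}[x]$ and $\mathbb{R}[x,y]$ are the rings of real polynomials in $x=(x_1,\ldots,x_n)$ and in $(x,y)=(x_1,\ldots,x_n,y_1,\ldots,y_m)$. $\mathrm{vol}(\cdot)$ denotes Lebesgue volume in $\mathbb{R}^n$, and $dx$ denotes integration with respect to Lebesgue measure. *)

theory Defs
  imports "HOL-Analysis.Analysis"
begin

text \<open>
  Polynomials in \<open>\<real>[x]\<close> and \<open>\<real>[x,y]\<close> enter only through their values, so they are represented as
  polynomial functions (\<^const>\<open>real_polynomial_function\<close>) on \<open>real ^ 'n\<close> and on
  \<open>real ^ 'n \<times> real ^ 'm\<close>.  These spaces are finite-dimensional, so the bounded linear generators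
  are exactly the linear forms in the coordinates.
\<close>

definition is_box :: "(real ^ 'n) set \<Rightarrow> bool" where
  "is_box B \<longleftrightarrow> (\<exists>a b. B = cbox a b)"

text \<open>Solid ellipsoids; \<open>Q\<close> is symmetric positive definite.\<close>

definition is_ellipsoid :: "(real ^ 'n) set \<Rightarrow> bool" where
  "is_ellipsoid B \<longleftrightarrow>
    (\<exists>(Q :: real ^ 'n ^ 'n) c.
       transpose Q = Q \<and> (\<forall>v. v \<noteq> 0 \<longrightarrow> v \<bullet> (Q *v v) > 0) \<and>
       B = {x. (x - c) \<bullet> (Q *v (x - c)) \<le> 1})"

definition semialg_set ::
    "(real ^ 'n) set \<Rightarrow> nat \<Rightarrow> (nat \<Rightarrow> (real ^ 'n) \<times> (real ^ 'm) \<Rightarrow> real)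
      \<Rightarrow> ((real ^ 'n) \<times> (real ^ 'm)) set" where
  "semialg_set B s g = {(x, y). x \<in> B \<and> (\<forall>j\<in>{1..s}. g j (x, y) \<ge> 0)}"

definition fiber :: "('a \<times> 'b) set \<Rightarrow> 'a \<Rightarrow> 'b set" where
  "fiber K x = {y. (x, y) \<in> K}"

text \<open>
  \<open>GREATEST\<close> denotes the maximum wherever it is attained, as for continuous \<open>f\<close> on a nonempty compact
  fiber, and is unspecified otherwise.
\<close>

definition J_max :: "('a \<times> 'b) set \<Rightarrow> ('a \<times> 'b \<Rightarrow> real) \<Rightarrow> 'a \<Rightarrow> real" where
  "J_max K f x = (GREATEST v. v \<in> (\<lambda>y. f (x, y)) ` fiber K x)"

definition D_set :: "'a set \<Rightarrow> ('a \<times> 'b) set \<Rightarrow> ('a \<times> 'b \<Rightarrow> real) \<Rightarrow> 'a set" where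
  "D_set B K f = {x \<in> B. \<exists>y\<in>fiber K x. f (x, y) \<ge> 0}"

definition D_approx :: "'a set \<Rightarrow> ('a \<Rightarrow> real) \<Rightarrow> 'a set" where
  "D_approx B p = {x \<in> B. p x \<ge> 0}"

end

theory Submission
  imports Defs
begin

text \<open>
  The exceptional set is \<open>J_max K f < 0 \<le> p k\<close>.  Its part where \<open>J_max K f > -c\<close> has small measure for
  small \<open>c\<close> uniformly in \<open>k\<close>, and on the rest \<open>\<bar>p k - J_max K f\<bar> \<ge> c\<close>, so Markov's inequality applies.
  Measurability holds because \<open>J_max K f\<close> is upper semicontinuous: its superlevel sets are projections
  of compact sets.
\<close>

lemma (in finite_measure) measure_sign_mismatch_tendsto_0:
  fixes u :: "'a \<Rightarrow> real" and q :: "nat \<Rightarrow> 'a \<Rightarrow> real"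
  assumes u [measurable]: "u \<in> borel_measurable M"
    and q: "\<And>k. integrable M (\<lambda>x. \<bar>q k x - u x\<bar>)"
    and q_meas [measurable]: "\<And>k. q k \<in> borel_measurable M"
    and lim: "(\<lambda>k. LINT x|M. \<bar>q k x - u x\<bar>) \<longlonglongrightarrow> 0"
  shows "(\<lambda>k. measure M {x \<in> space M. u x < 0 \<and> 0 \<le> q k x}) \<longlonglongrightarrow> 0"
proof (rule LIMSEQ_I)
  fix e :: real assume e: "0 < e"
  \<comment> \<open>These strips just below the zero level decrease to the empty set, since level
    zero itself is excluded. Finiteness of the measure then gives continuity from above, so one
    strip has measure below \<open>e / 2\<close>, with no reference to \<open>k\<close>.\<close>
  define A where "A n = {x \<in> space M. - (1 / real (Suc n)) < u x \<and> u x < 0}" for n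
  have A_sets [measurable]: "A n \<in> sets M" for n
    unfolding A_def by measurable
  have "decseq A"
  proof (rule decseq_SucI)
    fix n
    have "1 / real (Suc (Suc n)) \<le> 1 / real (Suc n)" by (simp add: frac_le)
    then show "A (Suc n) \<subseteq> A n" by (auto simp: A_def)
  qed
  then have "(\<lambda>n. measure M (A n)) \<longlonglongrightarrow> measure M (\<Inter>n. A n)"
    by (intro finite_Lim_measure_decseq) auto
  moreover have "(\<Inter>n. A n) = {}"
  proof (rule equals0I)
    fix x assume x: "x \<in> (\<Inter>n. A n)"
    then have "0 < - u x" by (auto simp: A_def)
    then obtain n where "inverse (real (Suc n)) < - u x"
      using reals_Archimedean by blast
    moreover have "- (1 / real (Suc n)) < u x" using x by (auto simp: A_def)
    ultimately show False by (simp add: inverse_eq_divide)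
  qed
  ultimately have "(\<lambda>n. measure M (A n)) \<longlonglongrightarrow> 0"
    by simp
  then have "\<forall>\<^sub>F n in sequentially. measure M (A n) < e / 2"
    by (rule order_tendstoD) (use e in simp)
  then obtain n where n: "measure M (A n) < e / 2"
    by (auto simp: eventually_sequentially)
  \<comment> \<open>The width of the chosen strip is also the Markov threshold: an integral below
    \<open>c * (e / 2)\<close> leaves \<open>e / 2\<close> after division by
    \<open>c\<close>.\<close>
  define c where "c = 1 / real (Suc n)"
  have c: "0 < c" by (simp add: c_def)
  have "\<forall>\<^sub>F k in sequentially. (LINT x|M. \<bar>q k x - u x\<bar>) < c * (e / 2)"
    using lim c e by (intro order_tendstoD) auto
  then obtain N where N: "\<And>k. k \<ge> N \<Longrightarrow> (LINT x|M. \<bar>q k x - u x\<bar>) < c * (e / 2)"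
    by (auto simp: eventually_sequentially)
  show "\<exists>N. \<forall>k\<ge>N. norm (measure M {x \<in> space M. u x < 0 \<and> 0 \<le> q k x} - 0) < e"
  proof (intro exI[of _ N] allI impI)
    fix k assume k: "N \<le> k"
    let ?E = "{x \<in> space M. c \<le> \<bar>q k x - u x\<bar>}"
    have "measure M ?E \<le> (LINT x|M. \<bar>q k x - u x\<bar>) / c"
      using q c by (intro integral_Markov_inequality_measure[where A = "{}"]) auto
    also have "\<dots> < e / 2"
      using N[OF k] c by (simp add: field_simps)
    finally have E: "measure M ?E < e / 2" .
    \<comment> \<open>Outside \<open>A n\<close>, \<open>u x < 0\<close> forces
      \<open>u x \<le> - c\<close>; together with \<open>0 \<le> q k x\<close> this gives a gap of
      at least \<open>c\<close>, so the point lies in \<open>?E\<close>.\<close>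
    have "measure M {x \<in> space M. u x < 0 \<and> 0 \<le> q k x} \<le> measure M (A n \<union> ?E)"
      by (intro finite_measure_mono) (auto simp: A_def c_def)
    also have "\<dots> \<le> measure M (A n) + measure M ?E"
      by (intro measure_Un_le) auto
    finally show "norm (measure M {x \<in> space M. u x < 0 \<and> 0 \<le> q k x} - 0) < e"
      using n E by simp
  qed
qed

lemma compact_fiber:
  fixes K :: "('a::t2_space \<times> 'b::t2_space) set"
  assumes "compact K"
  shows "compact (fiber K x)"
proof -
  have "fiber K x = snd ` (K \<inter> {x} \<times> UNIV)"
    by (force simp: fiber_def)
  moreover have "closed ({x} \<times> (UNIV :: 'b set))"
    by (intro closed_Times) auto
  ultimately show ?thesis
    using assms by (auto intro!: compact_continuous_image continuous_intros compact_Int_closed)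
qed

text \<open>A continuous function on a nonempty compact fiber attains its supremum, so the
  \<open>GREATEST\<close> in \<open>J_max\<close> is a genuine maximum. All later facts about
  \<open>J_max\<close> rest on this.\<close>

lemma J_max_attained:
  fixes K :: "('a::t2_space \<times> 'b::t2_space) set"
  assumes "compact K" "continuous_on K f" "fiber K x \<noteq> {}"
  obtains y where "y \<in> fiber K x" "J_max K f x = f (x, y)" "\<And>z. z \<in> fiber K x \<Longrightarrow> f (x, z) \<le> f (x, y)"
proof -
  have "continuous_on (fiber K x) (\<lambda>y. f (x, y))"
    by (rule continuous_on_compose2[OF assms(2)]) (auto intro!: continuous_intros simp: fiber_def)
  then obtain y where y: "y \<in> fiber K x" "\<And>z. z \<in> fiber K x \<Longrightarrow> f (x, z) \<le> f (x, y)"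
    using continuous_attains_sup[OF compact_fiber[OF assms(1)] assms(3)] by blast
  moreover have "J_max K f x = f (x, y)"
    unfolding J_max_def by (rule Greatest_equality) (use y in auto)
  ultimately show thesis using that by blast
qed

text \<open>Trades a bound on the maximum for the existence of a witness; this makes superlevel sets
  projections and identifies \<open>D_set\<close> with the level
  \<open>0 \<le> J_max K f x\<close>.\<close>

lemma J_max_ge_iff:
  fixes K :: "('a::t2_space \<times> 'b::t2_space) set"
  assumes "compact K" "continuous_on K f" "fiber K x \<noteq> {}"
  shows "c \<le> J_max K f x \<longleftrightarrow> (\<exists>y\<in>fiber K x. c \<le> f (x, y))"
  by (rule J_max_attained[OF assms]) (metis order_trans)

lemma J_max_superlevel_compact:
  fixes K :: "('a::t2_space \<times> 'b::t2_space) set"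
  assumes K: "compact K" and f: "continuous_on K f"
    and fibers: "\<And>x. x \<in> fst ` K \<Longrightarrow> fiber K x \<noteq> {}"
  shows "compact {x \<in> fst ` K. c \<le> J_max K f x}"
proof -
  have "{x \<in> fst ` K. c \<le> J_max K f x} = fst ` {z \<in> K. c \<le> f z}"
  proof (intro set_eqI iffI)
    fix x assume "x \<in> {x \<in> fst ` K. c \<le> J_max K f x}"
    then have x: "x \<in> fst ` K" "c \<le> J_max K f x" by auto
    then obtain y where "(x, y) \<in> K" "c \<le> f (x, y)"
      using J_max_ge_iff[OF K f fibers[OF x(1)]] by (auto simp: fiber_def)
    then show "x \<in> fst ` {z \<in> K. c \<le> f z}"
      by (intro image_eqI[of _ _ "(x, y)"]) auto
  next
    fix x assume "x \<in> fst ` {z \<in> K. c \<le> f z}"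
    then obtain y where y: "(x, y) \<in> K" "c \<le> f (x, y)" by auto
    then have x: "x \<in> fst ` K" by force
    then show "x \<in> {x \<in> fst ` K. c \<le> J_max K f x}"
      using J_max_ge_iff[OF K f fibers[OF x]] y by (auto simp: fiber_def)
  qed
  moreover have "compact {z \<in> K. c \<le> f z}"
  proof -
    have "closedin (top_of_set K) (K \<inter> f -` {c..})"
      using f by (intro continuous_closedin_preimage) auto
    then have "compact (K \<inter> f -` {c..})"
      using K by (rule closedin_compact[rotated])
    then show ?thesis by (simp add: Int_def vimage_def)
  qed
  ultimately show ?thesis
    by (auto intro!: compact_continuous_image continuous_intros)
qed

theorem corollary4:
  fixes B :: "(real ^ 'n) set"
    and s :: nat
    and g :: "nat \<Rightarrow> (real ^ 'n) \<times> (real ^ 'm) \<Rightarrow> real"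
    and K :: "((real ^ 'n) \<times> (real ^ 'm)) set"
    and f :: "(real ^ 'n) \<times> (real ^ 'm) \<Rightarrow> real"
    and p :: "nat \<Rightarrow> real ^ 'n \<Rightarrow> real"
  assumes B: "is_box B \<or> is_ellipsoid B"
    and g_poly: "\<And>j. j \<in> {1..s} \<Longrightarrow> real_polynomial_function (g j)"
    and K: "K = semialg_set B s g"
    and K_compact: "compact K"
    and fibers: "\<And>x. x \<in> B \<Longrightarrow> fiber K x \<noteq> {}"
    and f_poly: "real_polynomial_function f"
    and B_interior: "interior B \<noteq> {}"
    and D_interior: "interior (D_set B K f) \<noteq> {}"
    and J_zero: "{x \<in> B. J_max K f x = 0} \<in> null_sets lebesgue"
    and p_poly: "\<And>k. real_polynomial_function (p k)"
    and p_ge: "\<And>k x y. x \<in> B \<Longrightarrow> y \<in> fiber K x \<Longrightarrow> p k x \<ge> f (x, y)"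
    and p_lim: "(\<lambda>k. LINT x:B|lebesgue. \<bar>p k x - J_max K f x\<bar>) \<longlonglongrightarrow> 0"
  shows "(\<forall>k. D_set B K f \<subseteq> D_approx B (p k)) \<and>
         (\<lambda>k. measure lebesgue (D_approx B (p k) - D_set B K f)) \<longlonglongrightarrow> 0"
proof -
  have f: "continuous_on K f"
    using f_poly by (intro continuous_at_imp_continuous_on ballI continuous_real_polymonial_function)
  have B_eq: "B = fst ` K"
  proof
    show "B \<subseteq> fst ` K"
      using fibers by (force simp: fiber_def)
    show "fst ` K \<subseteq> B"
      by (auto simp: K semialg_set_def)
  qed
  have B_compact: "compact B"
    unfolding B_eq using K_compact by (intro compact_continuous_image continuous_intros)
  then have B_lmeas: "B \<in> lmeasurable"
    by (rule lmeasurable_compact)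
  then have [measurable]: "B \<in> sets lebesgue"
    by auto
  note J_ge = J_max_ge_iff[OF K_compact f]
  let ?J = "J_max K f"
  interpret M: finite_measure "lebesgue_on B"
    using B_lmeas by (rule finite_measure_lebesgue_on)
  \<comment> \<open>Closed upper rays generate the Borel sets of the line, so measurable superlevel
    sets suffice.\<close>
  have "{x \<in> B. c \<le> ?J x} \<in> sets (lebesgue_on B)" for c
  proof -
    have "compact {x \<in> B. c \<le> ?J x}"
      using J_max_superlevel_compact[OF K_compact f, of c] fibers unfolding B_eq by blast
    then have "{x \<in> B. c \<le> ?J x} \<in> sets lebesgue"
      by (intro fmeasurableD lmeasurable_compact)
    then show ?thesis
      by (simp add: sets_restrict_space_iff)
  qed
  then have J_meas: "?J \<in> borel_measurable (lebesgue_on B)"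
    by (simp add: borel_measurable_iff_ge)
  have p_cont: "continuous_on B (p k)" for k
    using p_poly by (intro continuous_at_imp_continuous_on ballI continuous_real_polymonial_function)
  then have p_meas: "p k \<in> borel_measurable (lebesgue_on B)" for k
    by (intro continuous_imp_measurable_on_sets_lebesgue) auto
  \<comment> \<open>Integrability cannot be read off \<open>p_lim\<close>, because the integral of a
    non-integrable function is 0 by convention. It comes instead from uniform bounds:
    \<open>?J\<close> takes values of \<open>f\<close> on the compact \<open>K\<close>, and each
    \<open>p k\<close> is continuous on the compact \<open>B\<close>.\<close>
  have "bounded (f ` K)"
    using f K_compact by (intro compact_imp_bounded compact_continuous_image)
  then obtain C where C: "\<And>z. z \<in> K \<Longrightarrow> \<bar>f z\<bar> \<le> C"
    by (auto simp: bounded_iff)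
  have J_bound: "\<bar>?J x\<bar> \<le> C" if x: "x \<in> B" for x
    by (rule J_max_attained[OF K_compact f fibers[OF x]]) (use C in \<open>auto simp: fiber_def\<close>)
  have int: "integrable (lebesgue_on B) (\<lambda>x. \<bar>p k x - ?J x\<bar>)" for k
  proof -
    have "bounded (p k ` B)"
      using p_cont B_compact by (intro compact_imp_bounded compact_continuous_image)
    then obtain P where P: "\<And>x. x \<in> B \<Longrightarrow> \<bar>p k x\<bar> \<le> P"
      by (auto simp: bounded_iff)
    have "AE x in lebesgue_on B. norm \<bar>p k x - ?J x\<bar> \<le> P + C"
    proof (rule AE_I2)
      fix x assume "x \<in> space (lebesgue_on B)"
      then have "x \<in> B" by simp
      then show "norm \<bar>p k x - ?J x\<bar> \<le> P + C"
        using P[of x] J_bound[of x] by simp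
    qed
    then show ?thesis
      using J_meas p_meas by (intro M.integrable_const_bound) auto
  qed
  \<comment> \<open>The set integral is passed to the restricted measure, whose space is exactly
    \<open>B\<close>, where \<open>J_max\<close> is a true maximum.\<close>
  have "(\<lambda>k. LINT x|lebesgue_on B. \<bar>p k x - ?J x\<bar>) \<longlonglongrightarrow> 0"
    using p_lim by (simp add: integral_restrict_space set_lebesgue_integral_def)
  from M.measure_sign_mismatch_tendsto_0[OF J_meas int p_meas this]
  have "(\<lambda>k. measure (lebesgue_on B) {x \<in> B. ?J x < 0 \<and> 0 \<le> p k x}) \<longlonglongrightarrow> 0"
    by simp
  \<comment> \<open>Points with \<open>?J x = 0\<close> belong to \<open>D_set\<close>, so the
    difference is cut out by the strict inequality \<open>?J x < 0\<close>, as in the convergence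
    lemma.\<close>
  moreover have "D_approx B (p k) - D_set B K f = {x \<in> B. ?J x < 0 \<and> 0 \<le> p k x}" for k
  proof -
    have "x \<in> D_set B K f \<longleftrightarrow> 0 \<le> ?J x" if "x \<in> B" for x
      using that J_ge[OF fibers[OF that], of 0] by (simp add: D_set_def)
    then show ?thesis by (auto simp: D_approx_def)
  qed
  ultimately have "(\<lambda>k. measure lebesgue (D_approx B (p k) - D_set B K f)) \<longlonglongrightarrow> 0"
    by (simp add: measure_restrict_space Collect_mono)
  moreover have "D_set B K f \<subseteq> D_approx B (p k)" for k
    unfolding D_set_def D_approx_def using p_ge by (blast intro: order_trans)
  ultimately show ?thesis by blast
qed

end
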